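(* Let $\mathcal{V}$ be a finite set of nodes with profiles over a schema of categorical attributes $\mathcal{A}=\{A_1,\ldots,A_m\}$, and let $\mathcal{D}$ be the profile set of $\mathcal{V}$. Then the entropy-based diversity function $div:2^{\mathcal{V}}\to\mathbb{R}$, $$div(S)=H(X_1,\ldots,X_{|S|})=\sum_{i=1}^{|S|}H(X_i\mid X_1,\ldots,X_{i-1}),$$ where $X_1,\ldots,X_{|S|}$ are the discrete random variables associated with the profiles of the nodes $v_1,\ldots,v_{|S|}$ of $S$, is (nondecreasing) monotone and submodular.
   Context: Each attribute $A$ has a finite domain $dom_A$ of admissible values, and $dom=\bigcup_{A\in\mathcal{A}}dom_A$. Each node $v\in\mathcal{V}$ has a profile $\mathcal{A}[v]$ giving, for each attribute $A$, either a value in $dom_A$ or a missing value. The profile set $\mathcal{D}$ is the multiset of profiles of all nodes in $\mathcal{V}$. The set $dom$ is equipped with the probability function that assigns to each $a\in dom$ its relative frequency in $\mathcal{D}$ (the number of occurrences of $a$ in the profiles of $\mathcal{D}$ divided by the total number of attribute-value occurrences in $\mathcal{D}$). For $S=\{v_1,\ldots,v_{|S|}\}\subseteq\mathcal{V}$, the random variable $X_i:dom\to\{0,1\}$ associated with $v_i$ takes value $1$ at $a$ if $a$ is contained in $\mathcal{A}[v_i]$, and $0$ otherwise. $H(X_1,\ldots,X_n)=\mathbb{E}[-\log P(X_1,\ldots,X_n)]$ is the joint Shannon entropy (with the empty joint entropy equal to $0$) and $H(\cdot\mid\cdot)$ is the conditional Shannon entropy. A set function $F:2^{\mathcal{V}}\to\mathbb{R}$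 is monotone if $F(S)\le F(T)$ whenever $S\subseteq T\subseteq\mathcal{V}$, and submodular if $F(S\cup\{v\})-F(S)\ge F(T\cup\{v\})-F(T)$ whenever $S\subseteq T\subseteq\mathcal{V}$ and $v\in\mathcal{V}\setminus T$. *)

theory Defs
  imports "HOL-Probability.Probability"
begin

text \<open>
  Nodes have type \<open>'v\<close>, attributes \<open>'a\<close>, attribute values \<open>'d\<close>. A profile maps each attribute
  to \<open>Some\<close> value or to \<open>None\<close> (missing value); only attributes in the schema \<open>As\<close> are relevant.
\<close>

type_synonym ('a, 'd) profile = "'a \<Rightarrow> 'd option"

definition full_dom :: "'a set \<Rightarrow> ('a \<Rightarrow> 'd set) \<Rightarrow> 'd set" where
  "full_dom As dm = (\<Union>A\<in>As. dm A)"

definition admissible_profile ::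
    "'a set \<Rightarrow> ('a \<Rightarrow> 'd set) \<Rightarrow> ('a, 'd) profile \<Rightarrow> bool" where
  "admissible_profile As dm p \<longleftrightarrow> (\<forall>A\<in>As. set_option (p A) \<subseteq> dm A)"

definition profile_set :: "'v set \<Rightarrow> ('v \<Rightarrow> ('a, 'd) profile) \<Rightarrow> ('a, 'd) profile multiset" where
  "profile_set V prof = image_mset prof (mset_set V)"

text \<open>
  Domains of different attributes may overlap, so one profile can contain the same value several
  times; each such occurrence is counted.
\<close>

definition occurrences :: "'a set \<Rightarrow> ('a, 'd) profile multiset \<Rightarrow> 'd \<Rightarrow> nat" where
  "occurrences As D a = (\<Sum>p\<in>#D. card {A \<in> As. p A = Some a})"

definition total_occurrences :: "'a set \<Rightarrow> ('a, 'd) profile multiset \<Rightarrow> nat" where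
  "total_occurrences As D = (\<Sum>p\<in>#D. card {A \<in> As. p A \<noteq> None})"

definition rel_freq :: "'a set \<Rightarrow> ('a, 'd) profile multiset \<Rightarrow> 'd \<Rightarrow> real" where
  "rel_freq As D a = real (occurrences As D a) / real (total_occurrences As D)"

text \<open>
  The sample space of all admissible values, weighted by relative frequency. If \<open>D\<close> contains no
  value at all, relative frequencies are undefined, and this is the null measure.
\<close>

definition value_space ::
    "'a set \<Rightarrow> ('a \<Rightarrow> 'd set) \<Rightarrow> ('a, 'd) profile multiset \<Rightarrow> 'd measure" where
  "value_space As dm D = point_measure (full_dom As dm) (\<lambda>a. ennreal (rel_freq As D a))"

lemma prob_space_value_space:
  assumes "finite As" and "\<And>A. A \<in> As \<Longrightarrow> finite (dm A)"
    and adm: "\<And>p. p \<in># D \<Longrightarrow> admissible_profile As dm p"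
    and pos: "total_occurrences As D > 0"
  shows "prob_space (value_space As dm D)"
proof -
  let ?U = "full_dom As dm"
  have fin: "finite ?U"
    using assms(1,2) by (auto simp: full_dom_def)
  have one: "(\<Sum>a\<in>?U. card {A \<in> As. p A = Some a}) = card {A \<in> As. p A \<noteq> None}"
    if "p \<in># D" for p
  proof -
    have "{A \<in> As. p A \<noteq> None} = (\<Union>a\<in>?U. {A \<in> As. p A = Some a})"
      using adm[OF that] by (fastforce simp: admissible_profile_def full_dom_def)
    moreover have "card (\<Union>a\<in>?U. {A \<in> As. p A = Some a}) = (\<Sum>a\<in>?U. card {A \<in> As. p A = Some a})"
      using fin assms(1) by (intro card_UN_disjoint) auto
    ultimately show ?thesis by simp
  qed
  have "(\<Sum>a\<in>?U. occurrences As D a) = (\<Sum>p\<in>#D. \<Sum>a\<in>?U. card {A \<in> As. p A = Some a})"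
    unfolding occurrences_def by (induction D) (simp_all add: sum.distrib)
  also have "\<dots> = total_occurrences As D"
    unfolding total_occurrences_def using one by (metis (no_types, lifting) image_mset_cong)
  finally have "(\<Sum>a\<in>?U. rel_freq As D a) = 1"
    using pos by (simp add: rel_freq_def flip: sum_divide_distrib of_nat_sum)
  then have "(\<Sum>a\<in>?U. ennreal (rel_freq As D a)) = 1"
    by (subst sum_ennreal) (auto simp: rel_freq_def)
  then show ?thesis
    unfolding value_space_def using fin
    by (intro prob_spaceI) (simp add: space_point_measure emeasure_point_measure_finite)
qed

definition node_rv :: "'a set \<Rightarrow> ('v \<Rightarrow> ('a, 'd) profile) \<Rightarrow> 'v \<Rightarrow> 'd \<Rightarrow> nat" where
  "node_rv As prof v a = of_bool (\<exists>A\<in>As. prof v A = Some a)"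

text \<open>The random vector \<open>(X\<^sub>1, \<dots>, X\<^sub>n)\<close> of a list of nodes, with lists as tuples.\<close>

definition joint_rv :: "'a set \<Rightarrow> ('v \<Rightarrow> ('a, 'd) profile) \<Rightarrow> 'v list \<Rightarrow> 'd \<Rightarrow> nat list" where
  "joint_rv As prof vs a = map (\<lambda>v. node_rv As prof v a) vs"

text \<open>
  The entropies \<open>\<H>(X)\<close> and \<open>\<H>(X | Y)\<close> of locale \<open>information_space\<close>, for discrete \<open>X\<close> and \<open>Y\<close> and
  logarithms to base \<open>b\<close>. The library constants are specified on probability spaces only; the
  value \<open>0\<close> elsewhere is a convention; by the lemma above, with finite domains and admissible
  profiles it only matters if no profile contains a value.
\<close>

definition discrete_entropy :: "real \<Rightarrow> 'd measure \<Rightarrow> ('d \<Rightarrow> 'x) \<Rightarrow> real" where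
  "discrete_entropy b M X =
     (if prob_space M then prob_space.entropy M b (count_space (X ` space M)) X else 0)"

definition discrete_cond_entropy ::
    "real \<Rightarrow> 'd measure \<Rightarrow> ('d \<Rightarrow> 'x) \<Rightarrow> ('d \<Rightarrow> 'y) \<Rightarrow> real" where
  "discrete_cond_entropy b M X Y =
     (if prob_space M
      then prob_space.conditional_entropy M b
             (count_space (X ` space M)) (count_space (Y ` space M)) X Y
      else 0)"

text \<open>
  \<open>div(S)\<close> is the joint entropy along an enumeration of \<open>S\<close>; the choice of the enumeration is
  immaterial for finite \<open>S\<close>, which is a claim to be proved.
\<close>

definition entropy_diversity ::
    "real \<Rightarrow> 'a set \<Rightarrow> ('a \<Rightarrow> 'd set) \<Rightarrow> ('v \<Rightarrow> ('a, 'd) profile) \<Rightarrow> 'v set \<Rightarrow> 'v set \<Rightarrow> real" where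
  "entropy_diversity b As dm prof V S =
     discrete_entropy b (value_space As dm (profile_set V prof))
       (joint_rv As prof (SOME vs. distinct vs \<and> set vs = S))"

definition submodular_on :: "'v set \<Rightarrow> ('v set \<Rightarrow> real) \<Rightarrow> bool" where
  "submodular_on V F \<longleftrightarrow>
     (\<forall>S T. \<forall>v \<in> V - T. S \<subseteq> T \<and> T \<subseteq> V \<longrightarrow>
        F (S \<union> {v}) - F S \<ge> F (T \<union> {v}) - F T)"

end

theory Submission
  imports Defs
begin

text \<open>
  Submodularity is the nonnegativity of conditional mutual information: with
  \<open>X = X\<^sub>v\<close>, \<open>Y\<close> the vector of \<open>T\<close> and \<open>Z\<close> the vector of \<open>S\<close>, the inequality
  \<open>0 \<le> I(X; Y | Z)\<close> reads \<open>H(X,Y,Z) - H(Y,Z) \<le> H(X,Z) - H(Z)\<close>. Monotonicity and independence of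
  the enumeration follow from data processing, since the vector of a set of nodes determines the
  vector of every list drawn from that set.
\<close>

context information_space
begin

text \<open>Points of \<open>A\<close> outside the range of \<open>X\<close> have probability 0 and
  contribute \<open>0 * log b 0 = 0\<close>. This matters because \<open>\<H>\<close> fixes the
  exact range as target, whereas a product of ranges can exceed the range of a pair.\<close>

lemma entropy_count_space_superset:
  assumes X: "simple_function M X" and A: "X ` space M \<subseteq> A" "finite A"
  shows "entropy b (count_space A) X = \<H>(X)"
proof -
  let ?P = "\<lambda>x. prob (X -` {x} \<inter> space M)"
  let ?Q = "\<lambda>x. if x \<in> X ` space M then ?P x else 0"
  have "distributed M (count_space A) X ?Q"
    by (rule distributed_simple_function_superset[OF X refl A])
  then have "entropy b (count_space A) X = - (\<integral>x. ?Q x * log b (?Q x) \<partial>count_space A)"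
    by (rule entropy_distr) simp
  also have "\<dots> = - (\<Sum>x\<in>A. ?Q x * log b (?Q x))"
    using A by (simp add: lebesgue_integral_count_space_finite)
  also have "(\<Sum>x\<in>A. ?Q x * log b (?Q x)) = (\<Sum>x\<in>X ` space M. ?P x * log b (?P x))"
    using A by (intro sum.mono_neutral_cong_right) auto
  also have "- \<dots> = \<H>(X)"
    by (rule entropy_simple_distributed[OF simple_distributedI[OF X measure_nonneg refl], symmetric])
  finally show ?thesis .
qed

lemma mutual_information_count_space_superset:
  assumes X: "simple_function M X" "X ` space M \<subseteq> A" "finite A"
    and Y: "simple_function M Y" "Y ` space M \<subseteq> B" "finite B"
  shows "mutual_information b (count_space A) (count_space B) X Y =
    \<H>(X) + \<H>(Y) - \<H>(\<lambda>x. (X x, Y x))"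
proof -
  have eq: "count_space A \<Otimes>\<^sub>M count_space B = count_space (A \<times> B)"
    using X Y by (simp add: pair_measure_count_space)
  have XY: "simple_function M (\<lambda>x. (X x, Y x))" "(\<lambda>x. (X x, Y x)) ` space M \<subseteq> A \<times> B" "finite (A \<times> B)"
    using X Y by (auto intro: simple_function_Pair)
  note d = distributed_simple_function_superset[OF _ refl]
  have "mutual_information b (count_space A) (count_space B) X Y =
    entropy b (count_space A) X + entropy b (count_space B) Y
    - entropy b (count_space A \<Otimes>\<^sub>M count_space B) (\<lambda>x. (X x, Y x))"
    by (rule mutual_information_eq_entropy_conditional_entropy_distr
          [OF _ _ d[OF X] _ d[OF Y] _ d[OF XY, folded eq]])
       (use X Y in \<open>auto simp: eq integrable_count_space sigma_finite_measure_count_space_finite\<close>)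
  then show ?thesis
    by (simp add: eq entropy_count_space_superset X Y XY)
qed

lemma entropy_submodular:
  assumes X: "simple_function M X" and Y: "simple_function M Y" and Z: "simple_function M Z"
  shows "\<H>(\<lambda>x. (X x, Y x, Z x)) + \<H>(Z) \<le> \<H>(\<lambda>x. (X x, Z x)) + \<H>(\<lambda>x. (Y x, Z x))"
proof -
  have fin: "finite (X ` space M)" "finite (Y ` space M)" "finite (Z ` space M)"
    using X Y Z by (auto dest: simple_functionD)
  have "0 \<le> \<I>(X ; Y | Z)"
    by (rule conditional_mutual_information_nonneg[OF X Y Z])
  also have "\<I>(X ; Y | Z) =
    (\<H>(X) + \<H>(\<lambda>x. (Y x, Z x)) - \<H>(\<lambda>x. (X x, Y x, Z x))) - (\<H>(X) + \<H>(Z) - \<H>(\<lambda>x. (X x, Z x)))"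
    unfolding conditional_mutual_information_def
    using fin X Y Z
    \<comment> \<open>The unfolded quantity is I(X; (Y, Z)) - I(X; Z), where (Y, Z) has the full
      product of the two ranges as target. The superset lemma turns both terms into
      entropies.\<close>
    by (subst pair_measure_count_space, simp, simp, subst (1 2) mutual_information_count_space_superset)
       (auto intro: simple_function_Pair)
  finally show ?thesis by simp
qed

lemma entropy_le_of_determined:
  assumes Y: "simple_function M Y" and X: "X = f \<circ> Y"
  shows "\<H>(X) \<le> \<H>(Y)"
  unfolding X by (rule entropy_data_processing[OF Y])

text \<open>Data processing in both directions; it serves to regroup tuples and lists of variables
  without changing the entropy.\<close>

lemma entropy_eq_of_determined:
  assumes X: "simple_function M X" and Y: "simple_function M Y"
    and XY: "X = f \<circ> Y" and YX: "Y = g \<circ> X"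
  shows "\<H>(X) = \<H>(Y)"
  using entropy_le_of_determined[OF Y XY] entropy_le_of_determined[OF X YX] by simp

lemma entropy_const: "\<H>(\<lambda>_. c) = 0"
proof -
  have "(\<lambda>_. c) ` space M = {c}" using not_empty by auto
  then show ?thesis
    using entropy_simple_distributed[OF simple_distributedI[OF simple_function_const measure_nonneg refl],
        of c]
    by (simp add: prob_space)
qed

end

text \<open>The values along \<open>ws\<close> form an association list in which each node of
  \<open>vs\<close> is looked up. Repeated nodes in \<open>ws\<close> are harmless, as they carry
  equal values.\<close>

lemma joint_rv_determined:
  assumes "set vs \<subseteq> set ws"
  shows "joint_rv As prof vs = (\<lambda>l. map (\<lambda>v. the (map_of (zip ws l) v)) vs) \<circ> joint_rv As prof ws"
  using assms by (auto simp: fun_eq_iff joint_rv_def map_of_zip_map)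

text \<open>On a finite space with all subsets measurable every function is simple, which discharges
  the side conditions of the entropy rules at once.\<close>

locale finite_information_space = information_space +
  assumes finite_space: "finite (space M)" and sets_eq_Pow: "sets M = Pow (space M)"
begin

abbreviation "joint_entropy As prof vs \<equiv> discrete_entropy b M (joint_rv As prof vs)"

lemma discrete_entropy_eq: "discrete_entropy b M X = \<H>(X)"
  by (simp add: discrete_entropy_def prob_space_axioms)

lemma discrete_cond_entropy_eq: "discrete_cond_entropy b M X Y = \<H>(X | Y)"
  by (simp add: discrete_cond_entropy_def prob_space_axioms)

lemma simple_function_all: "simple_function M X"
  using finite_space by (auto simp: simple_function_def sets_eq_Pow)

lemma joint_entropy_mono:
  "set vs \<subseteq> set ws \<Longrightarrow> joint_entropy As prof vs \<le> joint_entropy As prof ws"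
  unfolding discrete_entropy_eq
  by (rule entropy_le_of_determined[OF simple_function_all joint_rv_determined])

text \<open>Besides reordering this covers repetition, so lists with common nodes may be appended
  freely.\<close>

lemma joint_entropy_cong:
  "set vs = set ws \<Longrightarrow> joint_entropy As prof vs = joint_entropy As prof ws"
  by (intro antisym joint_entropy_mono) auto

lemma entropy_Pair_joint_rv:
  "\<H>(\<lambda>a. (joint_rv As prof vs a, joint_rv As prof ws a)) = joint_entropy As prof (vs @ ws)"
  unfolding discrete_entropy_eq
  by (rule entropy_eq_of_determined[OF simple_function_all simple_function_all,
        where f = "\<lambda>l. (take (length vs) l, drop (length vs) l)" and g = "\<lambda>(k, l). k @ l"])
     (auto simp: fun_eq_iff joint_rv_def)

lemma joint_entropy_submodular:
  "joint_entropy As prof (us @ vs @ ws) + joint_entropy As prof ws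
    \<le> joint_entropy As prof (us @ ws) + joint_entropy As prof (vs @ ws)"
proof -
  let ?J = "joint_rv As prof"
  \<comment> \<open>Merging the last two components yields a pair, to which
    \<open>entropy_Pair_joint_rv\<close> applies.\<close>
  have "\<H>(\<lambda>a. (?J us a, ?J vs a, ?J ws a)) = \<H>(\<lambda>a. (?J us a, ?J (vs @ ws) a))"
    by (rule entropy_eq_of_determined[OF simple_function_all simple_function_all,
          where f = "\<lambda>(k, l). (k, take (length vs) l, drop (length vs) l)"
            and g = "\<lambda>(k, l, m). (k, l @ m)"])
       (auto simp: fun_eq_iff joint_rv_def)
  moreover have "\<H>(\<lambda>a. (?J us a, ?J vs a, ?J ws a)) + \<H>(?J ws)
      \<le> \<H>(\<lambda>a. (?J us a, ?J ws a)) + \<H>(\<lambda>a. (?J vs a, ?J ws a))"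
    by (intro entropy_submodular simple_function_all)
  ultimately show ?thesis
    by (simp add: entropy_Pair_joint_rv discrete_entropy_eq[symmetric])
qed

lemma joint_entropy_snoc:
  "joint_entropy As prof (vs @ [v]) = joint_entropy As prof vs +
    discrete_cond_entropy b M (node_rv As prof v) (joint_rv As prof vs)"
proof -
  \<comment> \<open>The prefix comes first because \<open>entropy_chain_rule\<close> conditions on
    the first component.\<close>
  have "\<H>(\<lambda>a. (joint_rv As prof vs a, node_rv As prof v a)) = \<H>(joint_rv As prof (vs @ [v]))"
    by (rule entropy_eq_of_determined[OF simple_function_all simple_function_all,
          where f = "\<lambda>l. (butlast l, last l)" and g = "\<lambda>(l, x). l @ [x]"])
       (auto simp: fun_eq_iff joint_rv_def)
  then show ?thesis
    using entropy_chain_rule[OF simple_function_all simple_function_all,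
        of "joint_rv As prof vs" "node_rv As prof v"]
    by (simp add: discrete_entropy_eq discrete_cond_entropy_eq)
qed

lemma joint_entropy_chain_rule:
  "joint_entropy As prof vs = (\<Sum>i<length vs. discrete_cond_entropy b M
     (node_rv As prof (vs ! i)) (joint_rv As prof (take i vs)))"
\<comment> \<open>Appending at the right end keeps all earlier conditioning prefixes and adds a
  single summand.\<close>
proof (induction vs rule: rev_induct)
  case Nil
  have "joint_rv As prof [] = (\<lambda>_. [])" by (simp add: fun_eq_iff joint_rv_def)
  then show ?case by (simp add: discrete_entropy_eq entropy_const)
next
  case (snoc v vs)
  then show ?case by (simp add: joint_entropy_snoc nth_append)
qed

end

text \<open>Finiteness of \<open>V\<close> ensures that \<open>SOME\<close> picks a genuine
  enumeration of \<open>S\<close>; the premise \<open>cong\<close> then replaces it by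
  \<open>vs\<close>.\<close>

lemma entropy_diversity_eq:
  assumes "finite V" "S \<subseteq> V" "set vs = S"
    and cong: "\<And>vs ws. set vs = set ws \<Longrightarrow>
      discrete_entropy b (value_space As dm (profile_set V prof)) (joint_rv As prof vs) =
      discrete_entropy b (value_space As dm (profile_set V prof)) (joint_rv As prof ws)"
  shows "entropy_diversity b As dm prof V S =
    discrete_entropy b (value_space As dm (profile_set V prof)) (joint_rv As prof vs)"
proof -
  have "\<exists>ws. distinct ws \<and> set ws = S"
    using assms(1,2) finite_distinct_list finite_subset by metis
  then have "set (SOME ws. distinct ws \<and> set ws = S) = S"
    by (rule someI2_ex) simp
  then show ?thesis
    unfolding entropy_diversity_def using \<open>set vs = S\<close> by (intro cong) simp
qed

theorem proposition4:
  fixes V :: "'v set" and As :: "'a set" and dm :: "'a \<Rightarrow> 'd set"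
    and prof :: "'v \<Rightarrow> ('a, 'd) profile" and b :: real
  assumes "finite V" and "finite As"
    and "\<And>A. A \<in> As \<Longrightarrow> finite (dm A)"
    and "\<And>v. v \<in> V \<Longrightarrow> admissible_profile As dm (prof v)"
    and "b > 1"
  defines "M \<equiv> value_space As dm (profile_set V prof)"
    and "F \<equiv> entropy_diversity b As dm prof V"
  shows "(\<forall>S vs. S \<subseteq> V \<and> distinct vs \<and> set vs = S \<longrightarrow>
            F S = discrete_entropy b M (joint_rv As prof vs) \<and>
            F S = (\<Sum>i<length vs. discrete_cond_entropy b M
                     (node_rv As prof (vs ! i)) (joint_rv As prof (take i vs))))
         \<and> mono_on (Pow V) F
         \<and> submodular_on V F"
proof (cases "prob_space M")
  \<comment> \<open>By \<open>prob_space_value_space\<close> this occurs only if no profile contains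
    a value; all entropies and conditional entropies are then 0 by convention.\<close>
  case False
  then show ?thesis
    by (simp add: F_def M_def entropy_diversity_def discrete_entropy_def
        discrete_cond_entropy_def mono_on_def submodular_on_def)
next
  case True
  then interpret finite_information_space M b
    using assms(2,3,5)
    unfolding finite_information_space_def finite_information_space_axioms_def
      information_space_def information_space_axioms_def
    by (auto simp: M_def value_space_def space_point_measure sets_point_measure full_dom_def)
  have F: "F S = joint_entropy As prof vs" if "S \<subseteq> V" "set vs = S" for S vs
    unfolding F_def M_def
    by (rule entropy_diversity_eq[OF \<open>finite V\<close> that joint_entropy_cong[unfolded M_def]])
  have list: "\<exists>vs. set vs = S" if "S \<subseteq> V" for S
    using that \<open>finite V\<close> finite_list finite_subset by metis
  have "mono_on (Pow V) F"
  proof (rule mono_onI)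
    fix S T assume "S \<in> Pow V" "T \<in> Pow V" "S \<subseteq> T"
    moreover from this list obtain vs ws where "set vs = S" "set ws = T" by (metis PowD)
    ultimately show "F S \<le> F T" using joint_entropy_mono[of vs ws As prof] by (simp add: F)
  qed
  moreover have "submodular_on V F"
    unfolding submodular_on_def
  proof (intro allI ballI impI)
    fix S T v assume v: "v \<in> V - T" and ST: "S \<subseteq> T \<and> T \<subseteq> V"
    from ST list obtain vs ws where "set ws = S" "set vs = T" by (metis subset_trans)
    \<comment> \<open>As \<open>S \<subseteq> T\<close>, the list \<open>vs @ ws\<close> still lists
      exactly \<open>T\<close>, with nodes of \<open>S\<close> repeated. This puts \<open>T\<close>
      into the shape needed for conditioning on \<open>ws\<close>.\<close>
    with v ST have "F (T \<union> {v}) = joint_entropy As prof ([v] @ vs @ ws)"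
      "F (S \<union> {v}) = joint_entropy As prof ([v] @ ws)"
      "F T = joint_entropy As prof (vs @ ws)" "F S = joint_entropy As prof ws"
      by (auto intro!: F)
    then show "F (S \<union> {v}) - F S \<ge> F (T \<union> {v}) - F T"
      using joint_entropy_submodular[of As prof "[v]" vs ws] by linarith
  qed
  ultimately show ?thesis
    using F joint_entropy_chain_rule by metis
qed

end
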